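(* Let $S$ be a cap in $\Sigma=\mathrm{PG}(n,2)$, let $K_C$ be a hyperplane with $S\cap K_C=\{c_0\}$ (so $|C|=1$), and let $H_\infty\subset K_C$ be a subspace of codimension $2$ in $\Sigma$ with $S\cap H_\infty=\emptyset$. Let $K_A,K_B$ be the other two hyperplanes containing $H_\infty$, $H_A=K_A\setminus H_\infty$, $H_B=K_B\setminus H_\infty$, $A=S\cap H_A$, $B=S\cap H_B$, $B'=H_B\setminus B$. Suppose $B'=c_0+A$ and $|A|\neq 2^{n-2}$. If $A$ (or $B$) is not periodic, then $S$ is a complete cap.
   Context: Points of $\mathrm{PG}(n,2)$ are the nonzero vectors of $\mathbb{F}_2^{n+1}$; three distinct points $x,y,z$ are collinear iff $x+y=z$. A cap is a set of points with no three collinear; it is complete if not properly contained in another cap. $z+X=\{z+x:x\in X\}$. A set $X$ is periodic if some point $v$ satisfies $v+X=X$. *)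

theory Defs
  imports "HOL-Analysis.Cartesian_Space" "HOL-Library.Z2"
begin

text \<open>
  Points of PG(n,2) are the nonzero vectors of \<^typ>\<open>bit ^ 'm\<close>, where \<open>CARD('m) = n + 1\<close>.
  All geometric objects (caps, subspaces) are sets of points, so they never contain \<open>0\<close>.
\<close>

definition pg_points :: "(bit ^ 'm::finite) set" where
  "pg_points = {x. x \<noteq> 0}"

definition pg_collinear :: "bit ^ 'm::finite \<Rightarrow> bit ^ 'm \<Rightarrow> bit ^ 'm \<Rightarrow> bool" where
  "pg_collinear x y z \<longleftrightarrow>
     x \<in> pg_points \<and> y \<in> pg_points \<and> z \<in> pg_points \<and>
     x \<noteq> y \<and> y \<noteq> z \<and> x \<noteq> z \<and> x + y = z"

definition cap :: "(bit ^ 'm::finite) set \<Rightarrow> bool" where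
  "cap S \<longleftrightarrow> S \<subseteq> pg_points \<and> (\<forall>x\<in>S. \<forall>y\<in>S. \<forall>z\<in>S. \<not> pg_collinear x y z)"

definition complete_cap :: "(bit ^ 'm::finite) set \<Rightarrow> bool" where
  "complete_cap S \<longleftrightarrow> cap S \<and> (\<nexists>T. cap T \<and> S \<subset> T)"

text \<open>
  The codimension of a projective subspace equals that of the underlying linear subspace,
  and is stated additively to avoid truncated subtraction. The subspace may be empty
  (\<open>W = {0}\<close>), of projective dimension \<open>-1\<close>.
\<close>

definition pg_subspace_codim :: "nat \<Rightarrow> (bit ^ 'm::finite) set \<Rightarrow> bool" where
  "pg_subspace_codim d X \<longleftrightarrow>
     (\<exists>W. vec.subspace W \<and> vec.dim W + d = CARD('m) \<and> X = W - {0})"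

definition pg_hyperplane :: "(bit ^ 'm::finite) set \<Rightarrow> bool" where
  "pg_hyperplane K \<longleftrightarrow> pg_subspace_codim 1 K"

definition periodic :: "(bit ^ 'm::finite) set \<Rightarrow> bool" where
  "periodic X \<longleftrightarrow> (\<exists>v\<in>pg_points. (+) v ` X = X)"

end

theory Submission
  imports Defs
begin

text \<open>
  Let \<open>W = H_inf \<union> {0}\<close>. The three hyperplanes through \<open>W\<close> partition the space into \<open>W\<close> and three
  cosets of \<open>W\<close>, and the sum of vectors from two different cosets lies in the third. Let \<open>p\<close> be a point
  outside \<open>S\<close> that can be added to \<open>S\<close>.
  In \<open>H_A\<close> or \<open>H_B\<close> the equation \<open>B' = c0 + A\<close> writes \<open>p\<close> as a sum of \<open>c0\<close> and a point of \<open>S\<close>.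
  In \<open>K_C - H_inf\<close> the translate \<open>p + A\<close> avoids \<open>B\<close>, so \<open>p + A = B' = c0 + A\<close> by counting, and
  \<open>p + c0\<close> is a period of both \<open>A\<close> and \<open>B\<close>.
  In \<open>H_inf\<close> the sets \<open>A\<close> and \<open>B\<close> are disjoint from their translates by \<open>p\<close>, so each fills at most half
  of its coset; as \<open>card A + card B = card W\<close>, both fill exactly half, i.e. \<open>card A = 2^(n-2)\<close>.
\<close>

section \<open>Arithmetic and spans over the two-element field\<close>

instance bit :: finite
proof
  have "(UNIV :: bit set) = {0, 1}"
    using bit_not_one_iff by auto
  then show "finite (UNIV :: bit set)"
    by (metis finite.emptyI finite_insert)
qed

lemma bit_vec_add_self [simp]: "x + x = (0 :: bit ^ 'm)"
proof -
  have "b + b = 0" for b :: bit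
    by (cases b) auto
  then show ?thesis
    by (simp add: vec_eq_iff)
qed

lemma bit_vec_minus [simp]: "- x = (x :: bit ^ 'm)"
  by (simp add: minus_unique)

lemma bit_vec_diff [simp]: "x - y = x + (y :: bit ^ 'm)"
  by (metis bit_vec_minus diff_conv_add_uminus)

lemma bit_vec_add_left_cancel [simp]: "x + (x + y) = (y :: bit ^ 'm)"
  by (simp flip: add.assoc)

lemma bit_vec_add_right_cancel [simp]: "(y + x) + x = (y :: bit ^ 'm)"
  by (simp add: add.assoc)

text \<open>The only scalars are 0 and 1, so a new generator adds just one translate of the old
  span.\<close>

lemma bit_vec_span_insert:
  fixes x :: "bit ^ 'm::finite"
  shows "vec.span (insert x X) = vec.span X \<union> (+) x ` vec.span X"
proof -
  have "(\<exists>k. y - k *s x \<in> vec.span X) \<longleftrightarrow> y \<in> vec.span X \<or> x + y \<in> vec.span X" for y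
  proof -
    have "(\<exists>k :: bit. P k) \<longleftrightarrow> P 0 \<or> P 1" for P
      by (metis bit_not_one_iff)
    then show ?thesis
      by (simp add: add.commute)
  qed
  moreover have "x + y \<in> Y \<longleftrightarrow> y \<in> (+) x ` Y" for y Y
    by (metis bit_vec_add_left_cancel image_iff)
  ultimately show ?thesis
    by (auto simp only: vec.span_insert)
qed

section \<open>Cosets of subspaces and their cardinalities\<close>

lemma subspace_add_iff:
  assumes "vec.subspace W" "w \<in> W"
  shows "x + w \<in> W \<longleftrightarrow> x \<in> W" "w + x \<in> W \<longleftrightarrow> x \<in> W"
proof -
  show "x + w \<in> W \<longleftrightarrow> x \<in> W"
    using vec.subspace_add[OF assms(1) _ assms(2)] vec.subspace_diff[OF assms(1) _ assms(2)]
    by (metis add_diff_cancel)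
  then show "w + x \<in> W \<longleftrightarrow> x \<in> W"
    by (simp add: add.commute)
qed

lemma coset_disjoint:
  fixes x :: "bit ^ 'm::finite"
  assumes "vec.subspace W" "x \<notin> W"
  shows "W \<inter> (+) x ` W = {}"
  using assms by (auto simp: subspace_add_iff)

lemma card_translate: "card ((+) x ` X) = card (X :: (bit ^ 'm) set)"
  by (simp add: card_image)

lemma card_Un_coset:
  fixes x :: "bit ^ 'm::finite"
  assumes "vec.subspace W" "x \<notin> W"
  shows "card (W \<union> (+) x ` W) = 2 * card W"
  using assms by (simp add: card_Un_disjoint coset_disjoint card_translate)

text \<open>Build up a basis: each new independent vector lies outside the span so far, so its coset
  doubles the cardinality.\<close>

lemma card_bit_subspace:
  fixes W :: "(bit ^ 'm::finite) set"
  assumes "vec.subspace W"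
  shows "card W = 2 ^ vec.dim W"
proof -
  obtain X where X: "X \<subseteq> W" "vec.independent X" "W \<subseteq> vec.span X" "card X = vec.dim W"
    using vec.basis_exists by blast
  have "vec.independent Y \<Longrightarrow> card (vec.span Y) = 2 ^ card Y" if "finite Y" for Y :: "(bit ^ 'm) set"
    using that
  proof (induction Y)
    case (insert x Y)
    then have "x \<notin> vec.span Y" "vec.independent Y"
      by (auto simp: vec.independent_insert)
    with insert show ?case
      by (simp add: bit_vec_span_insert card_Un_coset)
  qed auto
  then have "card (vec.span X) = 2 ^ vec.dim W"
    using X(2,4) vec.finiteI_independent by metis
  moreover have "vec.span X = W"
    using X(1,3) vec.span_minimal[OF _ assms] by auto
  ultimately show ?thesis
    by simp
qed

lemma subspace_eq_Un_coset:
  fixes W V :: "(bit ^ 'm::finite) set"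
  assumes "vec.subspace W" "vec.subspace V" "W \<subseteq> V" "card V = 2 * card W" "x \<in> V" "x \<notin> W"
  shows "V = W \<union> (+) x ` W"
proof (rule sym, rule card_subset_eq)
  show "W \<union> (+) x ` W \<subseteq> V"
    using assms vec.subspace_add by blast
qed (use assms card_Un_coset in auto)

text \<open>A common \<open>x\<close> outside \<open>W\<close> would force both spaces to equal
  \<open>W\<close> together with the coset of \<open>x\<close>.\<close>

lemma subspace_Int_eq:
  fixes W V V' :: "(bit ^ 'm::finite) set"
  assumes "vec.subspace W" "vec.subspace V" "W \<subseteq> V" "card V = 2 * card W"
    and "vec.subspace V'" "W \<subseteq> V'" "card V' = 2 * card W" "V \<noteq> V'"
  shows "V \<inter> V' = W"
proof (rule ccontr)
  assume "V \<inter> V' \<noteq> W"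
  then obtain x where x: "x \<in> V" "x \<in> V'" "x \<notin> W"
    using assms(3,6) by blast
  then have "V = W \<union> (+) x ` W" "V' = W \<union> (+) x ` W"
    using assms by (metis subspace_eq_Un_coset)+
  then show False
    using assms(8) by simp
qed

lemma card_disjoint_translate_le:
  fixes A H :: "(bit ^ 'm::finite) set"
  assumes "A \<subseteq> H" "(+) p ` A \<subseteq> H" "A \<inter> (+) p ` A = {}"
  shows "2 * card A \<le> card H"
proof -
  have "2 * card A = card (A \<union> (+) p ` A)"
    using assms by (simp add: card_Un_disjoint card_translate)
  also have "\<dots> \<le> card H"
    using assms by (intro card_mono) auto
  finally show ?thesis .
qed

section \<open>Three hyperplanes through a subspace of codimension 2\<close>

text \<open>Cardinalities stand in for dimensions here. \<open>V1\<close>, \<open>V2\<close>,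
  \<open>V3\<close> will be \<open>K_A\<close>, \<open>K_B\<close>, \<open>K_C\<close> with 0 put
  back.\<close>

locale three_hyperplanes =
  fixes W V1 V2 V3 :: "(bit ^ 'm::finite) set"
  assumes sub_W: "vec.subspace W" "4 * card W = CARD(bit ^ 'm)"
    and sub_1: "vec.subspace V1" "W \<subseteq> V1" "card V1 = 2 * card W"
    and sub_2: "vec.subspace V2" "W \<subseteq> V2" "card V2 = 2 * card W"
    and sub_3: "vec.subspace V3" "W \<subseteq> V3" "card V3 = 2 * card W"
    and neq: "V1 \<noteq> V2" "V1 \<noteq> V3" "V2 \<noteq> V3"
begin

lemma Int_eq: "V1 \<inter> V2 = W" "V1 \<inter> V3 = W" "V2 \<inter> V3 = W"
  by (rule subspace_Int_eq[OF sub_W(1)]; fact sub_1 sub_2 sub_3 neq)+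

text \<open>\<open>W\<close> and the three differences are pairwise disjoint and each has
  \<open>card W\<close> elements, a quarter of the space.\<close>

lemma Un_eq: "V1 \<union> V2 \<union> V3 = UNIV"
proof (rule card_subset_eq)
  have card: "card (V1 - W) = card W" "card (V2 - W) = card W" "card (V3 - W) = card W"
    using sub_1 sub_2 sub_3 by (simp_all add: card_Diff_subset)
  have "V1 \<union> V2 \<union> V3 = W \<union> ((V1 - W) \<union> ((V2 - W) \<union> (V3 - W)))"
    using sub_1 by auto
  also have "card \<dots> = card W + card ((V1 - W) \<union> ((V2 - W) \<union> (V3 - W)))"
    by (intro card_Un_disjoint) auto
  also have "card ((V1 - W) \<union> ((V2 - W) \<union> (V3 - W))) = card (V1 - W) + card ((V2 - W) \<union> (V3 - W))"
    using Int_eq by (intro card_Un_disjoint) auto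
  also have "card ((V2 - W) \<union> (V3 - W)) = card (V2 - W) + card (V3 - W)"
    using Int_eq by (intro card_Un_disjoint) auto
  finally have "card (V1 \<union> V2 \<union> V3) = 4 * card W"
    using card by simp
  then show "card (V1 \<union> V2 \<union> V3) = CARD(bit ^ 'm)"
    by (simp only: sub_W(2))
qed auto

text \<open>The sum is in neither \<open>V1\<close> nor \<open>V3\<close>, since each contains
  exactly one summand; only \<open>V2 - W\<close> remains.\<close>

lemma add_mem:
  assumes "x \<in> V1 - W" "y \<in> V3 - W"
  shows "x + y \<in> V2 - W"
proof -
  have xy: "x \<in> V1" "y \<in> V3" "x \<notin> V3" "y \<notin> V1"
    using assms Int_eq(2) by auto
  then have "x + y \<notin> V1" "x + y \<notin> V3"
    using subspace_add_iff(2)[OF sub_1(1) xy(1)] subspace_add_iff(1)[OF sub_3(1) xy(2)] by auto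
  then show ?thesis
    using Un_eq sub_1(2) by blast
qed

end

text \<open>The case \<open>x = y\<close> is covered too, as the sum is then 0, which is not a
  point; later uses need no distinctness check.\<close>

lemma cap_sum_notin:
  assumes "cap T" "x \<in> T" "y \<in> T"
  shows "x + y \<notin> T"
proof
  assume xy: "x + y \<in> T"
  have nz: "x \<noteq> 0" "y \<noteq> 0" "x + y \<noteq> 0"
    using assms xy unfolding cap_def pg_points_def by auto
  then have "x \<noteq> y" by auto
  with nz have "pg_collinear x y (x + y)"
    by (auto simp: pg_collinear_def pg_points_def)
  with assms xy show False
    unfolding cap_def by blast
qed

theorem theorem3p3:
  fixes n :: nat
    and S K_A K_B K_C H_inf H_A H_B A B B' :: "(bit ^ 'm::finite) set"
    and c0 :: "bit ^ 'm"
  assumes dim: "CARD('m) = n + 1"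
    and S: "cap S"
    and K_C: "pg_hyperplane K_C" "S \<inter> K_C = {c0}"
    and H_inf: "pg_subspace_codim 2 H_inf" "H_inf \<subseteq> K_C" "S \<inter> H_inf = {}"
    and K_A: "pg_hyperplane K_A" "H_inf \<subseteq> K_A"
    and K_B: "pg_hyperplane K_B" "H_inf \<subseteq> K_B"
    and distinct: "K_A \<noteq> K_B" "K_A \<noteq> K_C" "K_B \<noteq> K_C"
    and H_A: "H_A = K_A - H_inf"
    and H_B: "H_B = K_B - H_inf"
    and A: "A = S \<inter> H_A"
    and B: "B = S \<inter> H_B"
    and B': "B' = H_B - B"
    and B'_eq: "B' = (+) c0 ` A"
    and card_A: "real (card A) \<noteq> 2 powi (int n - 2)"
    and not_periodic: "\<not> periodic A \<or> \<not> periodic B"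
  shows "complete_cap S"
proof -
  obtain W where W: "vec.subspace W" "vec.dim W + 2 = n + 1" "H_inf = W - {0}"
    using H_inf(1) dim by (auto simp: pg_subspace_codim_def)
  obtain V1 where V1: "vec.subspace V1" "vec.dim V1 = n" "K_A = V1 - {0}"
    using K_A(1) dim by (auto simp: pg_hyperplane_def pg_subspace_codim_def)
  obtain V2 where V2: "vec.subspace V2" "vec.dim V2 = n" "K_B = V2 - {0}"
    using K_B(1) dim by (auto simp: pg_hyperplane_def pg_subspace_codim_def)
  obtain V3 where V3: "vec.subspace V3" "vec.dim V3 = n" "K_C = V3 - {0}"
    using K_C(1) dim by (auto simp: pg_hyperplane_def pg_subspace_codim_def)
  have n: "n = Suc (vec.dim W)"
    using W(2) by simp
  have card_UNIV: "CARD(bit ^ 'm) = 2 ^ (n + 1)"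
    using card_bit_subspace[of "UNIV :: (bit ^ 'm) set"] dim
    by (simp only: vec.subspace_UNIV vec_dim_card)
  have zero: "0 \<in> W" "0 \<in> V1" "0 \<in> V2" "0 \<in> V3"
    using W V1 V2 V3 vec.subspace_0 by auto
  interpret three_hyperplanes W V1 V2 V3
  proof
    show "4 * card W = CARD(bit ^ 'm)"
      using card_UNIV W by (simp add: card_bit_subspace n)
    show "card V1 = 2 * card W" "card V2 = 2 * card W" "card V3 = 2 * card W"
      using W V1 V2 V3 by (simp_all add: card_bit_subspace n)
    show "W \<subseteq> V1" "W \<subseteq> V2" "W \<subseteq> V3"
      using W V1 V2 V3 zero K_A(2) K_B(2) H_inf(2) by auto
    show "V1 \<noteq> V2" "V1 \<noteq> V3" "V2 \<noteq> V3"
      using V1 V2 V3 distinct by auto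
  qed (use W V1 V2 V3 in auto)
  have HA: "H_A = V1 - W" and HB: "H_B = V2 - W"
    using H_A H_B W V1 V2 zero by auto
  have c0: "c0 \<in> S" "c0 \<in> V3 - W"
    using K_C(2) H_inf(3) V3 W by auto
  have AS: "A \<subseteq> S" "A \<subseteq> H_A" and BS: "B \<subseteq> S" "B \<subseteq> H_B"
    using A B by auto
  \<comment> \<open>Pointwise form of \<open>B' = c0 + A\<close>: translation by \<open>c0\<close>
    takes \<open>H_A\<close> into \<open>H_B\<close>, where \<open>B\<close> is the complement of
    \<open>B'\<close>.\<close>
  have B_iff: "x + c0 \<in> B \<longleftrightarrow> x \<notin> A" if "x \<in> H_A" for x
  proof -
    have "x + c0 \<in> H_B"
      using add_mem that c0(2) HA HB by auto
    moreover have "x + c0 \<in> (+) c0 ` A \<longleftrightarrow> x \<in> A"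
      by (simp add: add.commute[of x c0] inj_image_mem_iff)
    ultimately show ?thesis
      using B' B'_eq by blast
  qed
  have card_H: "card H_A = card W" "card H_B = card W"
    using sub_1 sub_2 by (simp_all add: HA HB card_Diff_subset)
  have H_shift: "x \<in> H_A \<Longrightarrow> x + w \<in> H_A" "x \<in> H_B \<Longrightarrow> x + w \<in> H_B" if "w \<in> W" for w x
    using that sub_W(1) sub_1(1,2) sub_2(1,2) by (auto simp: HA HB subspace_add_iff)
  have card_AB: "card A + card B = card W"
  proof -
    have "card (H_B - B) = card A"
      by (simp only: B'[symmetric] B'_eq card_translate)
    moreover have "card B \<le> card H_B"
      using BS by (intro card_mono) auto
    moreover have "card (H_B - B) = card H_B - card B"
      using BS by (intro card_Diff_subset) auto
    ultimately show ?thesis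
      using card_H by linarith
  qed
  show ?thesis
    unfolding complete_cap_def
  proof (intro conjI notI)
    assume "\<exists>T. cap T \<and> S \<subset> T"
    then obtain T p where T: "cap T" "S \<subseteq> T" "p \<in> T" "p \<notin> S"
      by blast
    have nosum: False if "x \<in> S" "y \<in> S" "x + y = p" for x y
      using cap_sum_notin[of T x y] T that by auto
    \<comment> \<open>Since \<open>x + (x + p) = p\<close>, this is \<open>nosum\<close> again, now
      saying that \<open>S\<close> is disjoint from its translate by \<open>p\<close>.\<close>
    have shift: "x + p \<notin> S" if "x \<in> S" for x
      using nosum[of x "x + p"] that by auto
    consider "p \<in> W" | "p \<in> V1 - W" | "p \<in> V2 - W" | "p \<in> V3 - W"
      using Un_eq by blast
    then show False
    proof cases
      case 1
      have "A \<inter> (+) p ` A = {}" "B \<inter> (+) p ` B = {}"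
        using shift AS BS by (fastforce simp: add.commute)+
      moreover have "(+) p ` A \<subseteq> H_A" "(+) p ` B \<subseteq> H_B"
        using AS(2) BS(2) 1 H_shift by (auto simp: add.commute[of p])
      ultimately have "2 * card A \<le> card W" "2 * card B \<le> card W"
        using AS(2) BS(2) card_disjoint_translate_le card_H by metis+
      then have "2 * card A = 2 ^ vec.dim W"
        using card_AB card_bit_subspace[OF W(1)] by linarith
      then have "2 * real (card A) = 2 ^ vec.dim W"
        by (metis of_nat_mult of_nat_numeral of_nat_power)
      \<comment> \<open>Here \<open>vec.dim W\<close> is n - 1. The integer exponent keeps this
        valid for n = 1, where n - 2 is -1.\<close>
      also have "\<dots> = 2 * 2 powi (int n - 2)"
        by (simp add: n power_int_diff)
      finally show False
        using card_A by simp
    next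
      case 2
      then have "p + c0 \<in> B"
        using B_iff T A HA by auto
      then show False
        using shift c0 BS by (metis add.commute subsetD)
    next
      case 3
      then have "p \<in> B'"
        using B' B T HB by auto
      then obtain a where "a \<in> A" "p = c0 + a"
        using B'_eq by auto
      then show False
        using nosum[of c0 a] c0(1) AS(1) by auto
    next
      case 4
      \<comment> \<open>The candidate period: it is nonzero because \<open>p \<noteq> c0\<close>,
        and lies in \<open>W\<close> because \<open>p\<close> and \<open>c0\<close> share a coset of
        \<open>W\<close>.\<close>
      define v where "v = p + c0"
      have "p \<noteq> c0" using T c0 by auto
      then have v0: "v \<in> pg_points"
        unfolding v_def pg_points_def
        by (metis (mono_tags) add.right_neutral bit_vec_add_left_cancel mem_Collect_eq)
      have "V3 = W \<union> (+) c0 ` W"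
        using c0(2) by (intro subspace_eq_Un_coset sub_W sub_3) auto
      with 4 obtain w where "w \<in> W" "p = c0 + w"
        by auto
      then have vW: "v \<in> W"
        by (simp add: v_def add.commute[of c0 w])
      \<comment> \<open>Otherwise \<open>B_iff\<close> would put \<open>a + v + c0 = a + p\<close>
        into \<open>B\<close>, against \<open>shift\<close>.\<close>
      have "a + v \<in> A" if "a \<in> A" for a
      proof (rule ccontr)
        assume "a + v \<notin> A"
        moreover have "a + v \<in> H_A"
          using that AS(2) vW H_shift(1) by auto
        ultimately have "a + v + c0 \<in> B"
          by (simp add: B_iff)
        moreover have "a + v + c0 = a + p"
          by (simp add: v_def add.assoc)
        ultimately have "a + p \<in> S"
          using BS(1) by auto
        then show False
          using shift that AS by blast
      qed
      then have A_iff: "a + v \<in> A \<longleftrightarrow> a \<in> A" for a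
        by (metis bit_vec_add_right_cancel)
      \<comment> \<open>The invariance of \<open>A\<close> under \<open>v\<close> passes to
        \<open>B' = c0 + A\<close>, and thence to its complement \<open>B\<close> in
        \<open>H_B\<close>.\<close>
      have B_shift: "b + v \<in> B" if "b \<in> B" for b
      proof -
        have "b + v \<in> H_B"
          using that BS(2) vW H_shift(2) by auto
        moreover have "b + v \<notin> B'"
        proof
          assume "b + v \<in> B'"
          then obtain a where a: "a \<in> A" "b + v = c0 + a"
            using B'_eq by auto
          then have "b = c0 + (a + v)"
            by (metis add.assoc bit_vec_add_right_cancel)
          then have "b \<in> B'"
            using B'_eq A_iff a(1) by auto
          then show False
            using that B' by auto
        qed
        ultimately show ?thesis
          using B' by auto
      qed
      \<comment> \<open>As \<open>v + v = 0\<close>, one inclusion already gives equality.\<close>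
      have period: "(+) v ` X = X" if "\<And>x. x \<in> X \<Longrightarrow> x + v \<in> X" for X
      proof
        show "(+) v ` X \<subseteq> X"
          using that by (auto simp: add.commute)
        show "X \<subseteq> (+) v ` X"
          using that by (metis add.commute bit_vec_add_left_cancel image_eqI subsetI)
      qed
      have "periodic A" "periodic B"
        using period A_iff B_shift v0 unfolding periodic_def by metis+
      with not_periodic show False
        by blast
    qed
  qed (fact S)
qed

end
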